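(* Let $n$ be an integer with $n \geq 2$ and let $K$ be a field such that $|K|\geq 3$. Then the maximal dimension of an affine subspace $\mathcal{S}$ of $M(n \times n, K)$ such that every element of $\mathcal{S}$ is nilpotent and has rank equal to $1$ is $n-2$.
   Context: $M(n\times n,K)$ denotes the $K$-vector space of $n \times n$ matrices over $K$. An affine subspace of a vector space $\mathcal{V}$ is a subset of the form $a+\mathcal{Z}$ with $a\in\mathcal{V}$ and $\mathcal{Z}$ a vector subspace of $\mathcal{V}$ (so it is nonempty and need not contain $0$); $\mathcal{Z}$ is called its direction, and the dimension of the affine subspace is $\dim(\mathcal{Z})$. "Maximal dimension" means that the stated value is attained by some such affine subspace and no such affine subspace has larger dimension. The field $K$ may be infinite. *)

theory Defs
  imports "HOL-Analysis.Analysis"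
begin

abbreviation matrix_scale :: "'k::field \<Rightarrow> 'k^'n^'m \<Rightarrow> 'k^'n^'m"
  where "matrix_scale c A \<equiv> map_matrix ((*) c) A"

text \<open>The matrices over an arbitrary field \<open>'k\<close> as a \<open>'k\<close>-vector space, giving
  \<open>matvs.subspace\<close> and \<open>matvs.dim\<close>. The library's \<open>(*s)\<close> on a nested vector type would take
  its scalars in the rows, so it is not the scalar multiplication needed here.\<close>

interpretation matvs: vector_space "matrix_scale :: 'k::field \<Rightarrow> 'k^'n^'m \<Rightarrow> 'k^'n^'m"
  by unfold_locales (simp_all add: vec_eq_iff algebra_simps)

text \<open>\<open>is_affine_subspace S Z\<close>: \<open>S\<close> is an affine subspace with direction \<open>Z\<close>; its dimension
  is then \<open>matvs.dim Z\<close>.\<close>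

definition is_affine_subspace :: "('k::field^'n^'m) set \<Rightarrow> ('k^'n^'m) set \<Rightarrow> bool"
  where "is_affine_subspace S Z \<longleftrightarrow> matvs.subspace Z \<and> (\<exists>A. S = (+) A ` Z)"

text \<open>The power is iterated matrix multiplication \<open>(**)\<close>; the type class operation \<open>A ^ k\<close>
  on vectors is componentwise.\<close>

definition nilpotent_matrix :: "'k::field^'n^'n \<Rightarrow> bool"
  where "nilpotent_matrix A \<longleftrightarrow> (\<exists>k::nat. ((**) A ^^ k) (mat 1) = 0)"

end

theory Submission
  imports Defs
begin

text \<open>If \<open>A + t B\<close> has rank 1 for every scalar \<open>t\<close>, then each of its \<open>2 \<times> 2\<close> minors is a
  polynomial of degree at most 2 in \<open>t\<close> with at least three roots, so all its coefficients
  vanish. For \<open>A = u v\<^sup>T\<close> this forces every \<open>B\<close> in the direction \<open>Z\<close> to have the form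
  \<open>u y\<^sup>T\<close> or \<open>x v\<^sup>T\<close>. Both forms make up a vector space of dimension \<open>n\<close>, and as \<open>Z\<close> is not the
  union of two proper subspaces, one of these spaces \<open>T\<close> contains \<open>Z\<close>. For matrices of
  rank 1, nilpotent means traceless, whence \<open>Z \<subset> {M \<in> T. trace M = 0} \<subset> T\<close>; the first
  inclusion is strict because \<open>A\<close> is not in \<open>Z\<close>, so \<open>dim Z \<le> n - 2\<close>.\<close>

section \<open>Inclusion and dimension of subspaces\<close>

text \<open>If \<open>x\<close> lies only in \<open>T\<close> and \<open>y\<close> only in
  \<open>S\<close>, then \<open>x + y\<close> lies in neither: subtracting the summand that belongs
  to the subspace would bring in the other one.\<close>

lemma (in module) subspace_subset_Un_cases:
  assumes "subspace Z" "subspace S" "subspace T" "Z \<subseteq> S \<union> T"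
  shows "Z \<subseteq> S \<or> Z \<subseteq> T"
proof (rule ccontr)
  assume "\<not> ?thesis"
  then obtain x y where x: "x \<in> Z" "x \<notin> S" and y: "y \<in> Z" "y \<notin> T"
    by blast
  with assms have "x \<in> T" "y \<in> S" "x + y \<in> S \<union> T"
    by (auto intro: subspace_add)
  with x y show False
    using subspace_diff[OF assms(2), of "x + y" y] subspace_diff[OF assms(3), of "x + y" x]
    by auto
qed

text \<open>A vector of \<open>W\<close> outside \<open>V\<close> enlarges a basis of
  \<open>V\<close> to an independent subset of \<open>W\<close>. The finite set \<open>E\<close>
  makes the basis \<open>C\<close> of \<open>W\<close> finite, so that cardinalities can be
  compared.\<close>

lemma (in vector_space) dim_less_of_psubset:
  assumes "subspace V" "V \<subset> W" "W \<subseteq> span E" "finite E"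
  shows "dim V < dim W"
proof -
  obtain B where B: "B \<subseteq> V" "independent B" "V \<subseteq> span B" "card B = dim V"
    by (rule basis_exists)
  obtain C where C: "C \<subseteq> W" "independent C" "W \<subseteq> span C" "card C = dim W"
    by (rule basis_exists)
  have finC: "finite C"
    using independent_span_bound[OF assms(4) C(2)] C(1) assms(3) by blast
  obtain a where a: "a \<in> W" "a \<notin> V"
    using assms(2) by blast
  have "span B \<subseteq> V"
    using B(1) assms(1) by (rule span_minimal)
  then have "a \<notin> span B"
    using a by blast
  then have "independent (insert a B)"
    using B(2) by (rule independent_insertI)
  moreover have "insert a B \<subseteq> span C"
    using a B(1) C(3) assms(2) by blast
  ultimately have "finite (insert a B) \<and> card (insert a B) \<le> card C"
    by (rule independent_span_bound[OF finC])
  moreover have "a \<notin> B"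
    using a B(1) by blast
  ultimately show ?thesis
    using B(4) C(4) by (auto simp: card_insert_if)
qed

section \<open>Rank 1 and nilpotency through outer products\<close>

definition outer :: "'k::field^'m \<Rightarrow> 'k^'n \<Rightarrow> 'k^'n^'m"
  where "outer u v = (\<chi> i j. u $ i * v $ j)"

lemma outer_nth [simp]: "outer u v $ i $ j = u $ i * v $ j"
  by (simp add: outer_def)

text \<open>The rank is the dimension of the span of the rows. If it is 1, all rows are multiples of
  one vector \<open>v\<close>, and the multipliers are the entries of the left factor.\<close>

lemma rank_eq_1_iff:
  fixes A :: "'k::field^'n^'m"
  shows "rank A = 1 \<longleftrightarrow> A \<noteq> 0 \<and> (\<exists>u v. A = outer u v)"
proof (intro iffI conjI)
  assume r: "rank A = 1"
  show "A \<noteq> 0"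
  proof
    assume "A = 0"
    then have "rows A \<subseteq> {0}"
      by (auto simp: rows_def row_def vec_eq_iff)
    then show False
      using r vec.dim_eq_0[of "rows A"] by (simp add: row_rank_def_gen)
  qed
  obtain B where B: "rows A \<subseteq> vec.span B" "card B = vec.dim (rows A)"
    by (rule vec.basis_exists)
  with r obtain v where "B = {v}"
    by (auto simp: row_rank_def_gen card_1_singleton_iff)
  with B have "\<exists>c. row i A = c *s v" for i
    by (auto simp: rows_def vec.span_singleton)
  then obtain c where c: "row i A = c i *s v" for i
    by metis
  have "A = outer (\<chi> i. c i) v"
    using c by (simp add: vec_eq_iff row_def)
  then show "\<exists>u v. A = outer u v"
    by blast
next
  assume "A \<noteq> 0 \<and> (\<exists>u v. A = outer u v)"
  then obtain u v where A: "A \<noteq> 0" "A = outer u v"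
    by blast
  have "row i A = u $ i *s v" for i
    by (simp add: A(2) row_def vec_eq_iff)
  then have "rows A \<subseteq> vec.span {v}"
    by (auto simp: rows_def vec.span_singleton)
  then have "vec.dim (rows A) \<le> 1"
    using vec.dim_le_card[of "rows A" "{v}"] by simp
  moreover have "\<not> rows A \<subseteq> {0}"
  proof
    assume "rows A \<subseteq> {0}"
    then have "row i A = 0" for i
      by (auto simp: rows_def)
    then show False
      using A(1) by (simp add: row_def vec_eq_iff)
  qed
  then have "vec.dim (rows A) \<noteq> 0"
    using vec.dim_eq_0[of "rows A"] by blast
  ultimately show "rank A = 1"
    unfolding row_rank_def_gen by linarith
qed

text \<open>Since \<open>v\<^sup>T u\<close> is the trace of \<open>A = u v\<^sup>T\<close>, the
  square of \<open>A\<close> is \<open>trace A\<close> times \<open>A\<close>. So the power with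
  exponent \<open>k + 1\<close> is \<open>A\<close> scaled by \<open>trace A ^ k\<close>.\<close>

lemma nilpotent_outer_iff:
  fixes u v :: "'k::field^'n"
  shows "nilpotent_matrix (outer u v) \<longleftrightarrow> trace (outer u v) = 0"
proof
  let ?A = "outer u v"
  have mult: "?A ** matrix_scale c ?A = matrix_scale (c * trace ?A) ?A" for c
    by (simp add: vec_eq_iff matrix_matrix_mult_def trace_def sum_distrib_left
        sum_distrib_right mult_ac)
  have pow: "((**) ?A ^^ Suc k) (mat 1) = matrix_scale (trace ?A ^ k) ?A" for k
  proof (induction k)
    case 0
    show ?case by (simp add: vec_eq_iff)
  next
    case (Suc k)
    then show ?case
      unfolding funpow.simps(2)[of "Suc k"] o_apply Suc.IH mult by (simp only: power_Suc2)
  qed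
  show "trace ?A = 0" if "nilpotent_matrix ?A"
  proof -
    obtain k where k: "((**) ?A ^^ k) (mat 1) = 0"
      using \<open>nilpotent_matrix ?A\<close> by (auto simp: nilpotent_matrix_def)
    have "(mat 1 :: 'k^'n^'n) \<noteq> 0"
      by (auto simp: vec_eq_iff mat_def)
    with k obtain l where "k = Suc l"
      by (cases k) auto
    with k pow[of l] have "matrix_scale (trace ?A ^ l) ?A = 0"
      by simp
    then have "trace ?A = 0 \<or> ?A = 0"
      by (auto simp: matvs.scale_eq_0_iff)
    moreover have "trace (0 :: 'k^'n^'n) = 0"
      by (simp add: trace_def)
    ultimately show ?thesis
      by metis
  qed
  show "nilpotent_matrix ?A" if "trace ?A = 0"
    unfolding nilpotent_matrix_def
    using pow[of 1] that by (intro exI[of _ "Suc 1"]) (simp add: vec_eq_iff)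
qed

section \<open>Traceless matrices and spaces with a fixed outer factor\<close>

lemma subspace_traceless:
  fixes T :: "('k::field^'n^'n) set"
  assumes "matvs.subspace T"
  shows "matvs.subspace {M \<in> T. trace M = 0}"
proof -
  have "trace (matrix_scale c M) = c * trace M" for c :: 'k and M :: "'k^'n^'n"
    by (simp add: trace_def sum_distrib_left)
  moreover have "trace (0 :: 'k^'n^'n) = 0"
    by (simp add: trace_def)
  ultimately show ?thesis
    using assms by (auto simp: matvs.subspace_def trace_add)
qed

lemma subspace_range_outer_left:
  fixes u :: "'k::field^'m"
  shows "matvs.subspace (range (outer u :: 'k^'n \<Rightarrow> _))"
proof (rule matvs.subspaceI)
  have "outer u (0 :: 'k^'n) = 0"
    by (simp add: vec_eq_iff)
  then show "0 \<in> range (outer u :: 'k^'n \<Rightarrow> 'k^'n^'m)"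
    by (rule range_eqI[OF sym])
next
  fix x y :: "'k^'n^'m" assume "x \<in> range (outer u)" "y \<in> range (outer u)"
  then obtain a b where "x = outer u a" "y = outer u b"
    by blast
  then have "x + y = outer u (a + b)"
    by (simp add: vec_eq_iff algebra_simps)
  then show "x + y \<in> range (outer u)"
    by blast
next
  fix c and x :: "'k^'n^'m" assume "x \<in> range (outer u)"
  then obtain a where "x = outer u a"
    by blast
  then have "matrix_scale c x = outer u (c *s a)"
    by (simp add: vec_eq_iff algebra_simps)
  then show "matrix_scale c x \<in> range (outer u)"
    by blast
qed

lemma subspace_range_outer_right:
  fixes v :: "'k::field^'n"
  shows "matvs.subspace (range (\<lambda>x :: 'k^'m. outer x v))"
proof (rule matvs.subspaceI)
  have "outer (0 :: 'k^'m) v = 0"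
    by (simp add: vec_eq_iff)
  then show "0 \<in> range (\<lambda>x. outer x v :: 'k^'n^'m)"
    by (rule range_eqI[OF sym])
next
  fix x y :: "'k^'n^'m" assume "x \<in> range (\<lambda>x. outer x v)" "y \<in> range (\<lambda>x. outer x v)"
  then obtain a b where "x = outer a v" "y = outer b v"
    by blast
  then have "x + y = outer (a + b) v"
    by (simp add: vec_eq_iff algebra_simps)
  then show "x + y \<in> range (\<lambda>x. outer x v)"
    by blast
next
  fix c and x :: "'k^'n^'m" assume "x \<in> range (\<lambda>x. outer x v)"
  then obtain a where "x = outer a v"
    by blast
  then have "matrix_scale c x = outer (c *s a) v"
    by (simp add: vec_eq_iff algebra_simps)
  then show "matrix_scale c x \<in> range (\<lambda>x. outer x v)"
    by blast
qed

lemma sum_axis_nth: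
  fixes f :: "'n::finite \<Rightarrow> 'k::field"
  shows "(\<Sum>k\<in>UNIV. f k * axis k 1 $ j) = f j"
proof -
  have "(\<Sum>k\<in>UNIV. f k * axis k 1 $ j) = (\<Sum>k\<in>UNIV. if k = j then f k else 0)"
    by (rule sum.cong) (auto simp: axis_def)
  then show ?thesis
    by simp
qed

lemma range_outer_left_span:
  fixes u :: "'k::field^'m"
  shows "range (outer u :: 'k^'n \<Rightarrow> _) \<subseteq> matvs.span (range (\<lambda>j. outer u (axis j 1)))"
proof (rule image_subsetI)
  fix y :: "'k^'n"
  have "outer u y = (\<Sum>k\<in>UNIV. matrix_scale (y $ k) (outer u (axis k 1)))"
    by (simp add: vec_eq_iff sum_axis_nth mult.left_commute flip: sum_distrib_left)
  then show "outer u y \<in> matvs.span (range (\<lambda>j. outer u (axis j 1)))"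
    by (simp only:) (intro matvs.span_sum matvs.span_scale matvs.span_base rangeI)
qed

lemma range_outer_right_span:
  fixes v :: "'k::field^'n"
  shows "range (\<lambda>x :: 'k^'m. outer x v) \<subseteq> matvs.span (range (\<lambda>i. outer (axis i 1) v))"
proof (rule image_subsetI)
  fix x :: "'k^'m"
  have "outer x v = (\<Sum>k\<in>UNIV. matrix_scale (x $ k) (outer (axis k 1) v))"
    by (simp add: vec_eq_iff sum_axis_nth flip: mult.assoc sum_distrib_right)
  then show "outer x v \<in> matvs.span (range (\<lambda>i. outer (axis i 1) v))"
    by (simp only:) (intro matvs.span_sum matvs.span_scale matvs.span_base rangeI)
qed

text \<open>In the chain from \<open>Z\<close> through the traceless part of \<open>T\<close> to
  \<open>T\<close>, both inclusions are strict, witnessed by \<open>A\<close> and by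
  \<open>D\<close>. As \<open>f\<close> is indexed by \<open>'n\<close>, \<open>dim T\<close> is at
  most \<open>CARD('n)\<close>. The chain also forces \<open>CARD('n)\<close> to be at least 2, so
  the subtraction does not truncate.\<close>

lemma dim_traceless_bound:
  fixes T Z :: "('k::field^'n^'n) set"
  assumes T: "matvs.subspace T" "T \<subseteq> matvs.span (range (f :: 'n \<Rightarrow> _))"
    and D: "D \<in> T" "trace D \<noteq> 0"
    and A: "A \<in> T" "trace A = 0" "A \<notin> Z"
    and Z: "matvs.subspace Z" "Z \<subseteq> T" "\<And>B. B \<in> Z \<Longrightarrow> trace B = 0"
  shows "matvs.dim Z \<le> CARD('n) - 2"
proof -
  let ?U = "{M \<in> T. trace M = 0}"
  have "matvs.dim Z < matvs.dim ?U"
    by (rule matvs.dim_less_of_psubset[OF Z(1), where E = "range f"]) (use Z A T in auto)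
  moreover have "matvs.dim ?U < matvs.dim T"
    by (rule matvs.dim_less_of_psubset[OF subspace_traceless, where E = "range f"])
      (use T D in auto)
  moreover have "matvs.dim T \<le> card (range f)"
    using T(2) by (intro matvs.dim_le_card) auto
  moreover have "card (range f) \<le> CARD('n)"
    by (rule card_image_le) simp
  ultimately show ?thesis
    by linarith
qed

section \<open>Directions that keep the rank at 1\<close>

text \<open>The polynomial \<open>s * X + s * s * Y\<close> has the roots 0, 1 and \<open>t\<close>;
  the root 0 is built in by the missing constant term.\<close>

lemma quadratic_coeffs_zero:
  fixes X Y :: "'k::field"
  assumes "t \<noteq> 0" "t \<noteq> 1" "X + Y = 0" "t * X + t * t * Y = 0"
  shows "X = 0" "Y = 0"
proof -
  have "X = - Y"
    using assms(3) by (simp add: eq_neg_iff_add_eq_0)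
  with assms(4) have "t * (t - 1) * Y = 0"
    by (simp add: algebra_simps)
  with assms show "Y = 0" by simp
  with \<open>X = - Y\<close> show "X = 0" by simp
qed

lemma direction_of_rank_1:
  fixes u :: "'k::field^'m" and v :: "'k^'n"
  assumes t: "t \<noteq> 0" "t \<noteq> 1" and nz: "outer u v \<noteq> 0"
    and B1: "outer u v + B = outer u1 v1"
    and Bt: "outer u v + matrix_scale t B = outer u2 v2"
  shows "B \<in> range (outer u) \<union> range (\<lambda>x. outer x v)"
proof -
  obtain p q where "outer u v $ p $ q \<noteq> 0"
    using nz by (auto simp: vec_eq_iff)
  then have up: "u $ p \<noteq> 0" and vq: "v $ q \<noteq> 0"
    by auto
  \<comment> \<open>The minor of \<open>outer u v + s B\<close> on rows \<open>i\<close>,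
    \<open>p\<close> and columns \<open>j\<close>, \<open>q\<close> is
    \<open>s * ?X i j + s * s * ?Y i j\<close>. Minors through the single nonzero entry at
    \<open>p\<close>, \<open>q\<close> suffice.\<close>
  have mixed: "u $ i * v $ j * B $ p $ q + u $ p * v $ q * B $ i $ j
      - u $ i * v $ q * B $ p $ j - u $ p * v $ j * B $ i $ q = 0" (is "?X i j = 0")
    and minor: "B $ i $ j * B $ p $ q - B $ i $ q * B $ p $ j = 0" (is "?Y i j = 0") for i j
  proof -
    have e1: "u $ k * v $ l + B $ k $ l = u1 $ k * v1 $ l" for k l
      using arg_cong[OF B1, of "\<lambda>M. M $ k $ l"] by simp
    have et: "u $ k * v $ l + t * B $ k $ l = u2 $ k * v2 $ l" for k l
      using arg_cong[OF Bt, of "\<lambda>M. M $ k $ l"] by simp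
    have "?X i j + ?Y i j = (u $ i * v $ j + B $ i $ j) * (u $ p * v $ q + B $ p $ q)
        - (u $ i * v $ q + B $ i $ q) * (u $ p * v $ j + B $ p $ j)"
      by (simp add: algebra_simps)
    also have "\<dots> = 0"
      unfolding e1 by simp
    finally have 1: "?X i j + ?Y i j = 0" .
    have "t * ?X i j + t * t * ?Y i j
        = (u $ i * v $ j + t * B $ i $ j) * (u $ p * v $ q + t * B $ p $ q)
        - (u $ i * v $ q + t * B $ i $ q) * (u $ p * v $ j + t * B $ p $ j)"
      by (simp add: algebra_simps)
    also have "\<dots> = 0"
      unfolding et by simp
    finally have 2: "t * ?X i j + t * t * ?Y i j = 0" .
    show "?X i j = 0" "?Y i j = 0"
      using quadratic_coeffs_zero[OF t 1 2] by auto
  qed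
  \<comment> \<open>Normalised so that column \<open>q\<close> of \<open>B\<close> agrees with
    \<open>outer x v\<close>, row \<open>p\<close> with \<open>outer u y\<close>, and their common
    entry with \<open>c\<close> times that of \<open>outer u v\<close>.\<close>
  define c where "c = B $ p $ q / (u $ p * v $ q)"
  define x where "x = (\<chi> i. B $ i $ q / v $ q)"
  define y where "y = (\<chi> j. B $ p $ j / u $ p)"
  have Bpq: "B $ p $ q = c * (u $ p * v $ q)"
    and Biq: "B $ i $ q = x $ i * v $ q" and Bpj: "B $ p $ j = u $ p * y $ j" for i j
    using up vq by (simp_all add: c_def x_def y_def)
  \<comment> \<open>This is the vanishing linear coefficient divided by
    \<open>u $ p * v $ q\<close>.\<close>
  have Bij: "B $ i $ j = u $ i * y $ j + x $ i * v $ j - c * u $ i * v $ j" for i j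
  proof -
    have "(u $ p * v $ q) * (B $ i $ j - (u $ i * y $ j + x $ i * v $ j - c * u $ i * v $ j)) = 0"
      using mixed[of i j, unfolded Bpq, unfolded Biq Bpj] by (simp add: algebra_simps)
    then show ?thesis
      using up vq by simp
  qed
  \<comment> \<open>With \<open>Bij\<close> inserted, the quadratic coefficient factors. Hence
    \<open>x = c u\<close> or \<open>y = c v\<close>, and either equation cancels the term with
    \<open>c\<close> in \<open>Bij\<close>.\<close>
  have prod: "(x $ i - c * u $ i) * (y $ j - c * v $ j) = 0" for i j
  proof -
    have "(u $ p * v $ q) * ((x $ i - c * u $ i) * (y $ j - c * v $ j)) = - ?Y i j"
      unfolding Bpq unfolding Biq Bpj unfolding Bij by (simp add: algebra_simps)
    then show ?thesis
      using minor[of i j] up vq by simp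
  qed
  show ?thesis
  proof (cases "\<forall>i. x $ i = c * u $ i")
    case True
    then have "B = outer u y"
      by (simp add: vec_eq_iff Bij algebra_simps)
    then show ?thesis by blast
  next
    case False
    then have "\<forall>j. y $ j = c * v $ j"
      using prod by auto
    then have "B = outer x v"
      by (simp add: vec_eq_iff Bij algebra_simps)
    then show ?thesis by blast
  qed
qed

lemma trace_outer_axis_left: "trace (outer (axis i 1) w) = (w $ i :: 'k::field)"
  by (simp add: trace_def axis_def if_distrib[of "\<lambda>x. x * _"] cong: if_cong)

lemma trace_outer_axis_right: "trace (outer w (axis i 1)) = (w $ i :: 'k::field)"
  using trace_outer_axis_left[of i w] by (simp add: trace_def mult.commute)

text \<open>\<open>CARD\<close> is 0 on an infinite type, hence the disjunction. The result supplies
  the scalar \<open>t\<close> besides 0 and 1.\<close>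

lemma exists_third_element:
  fixes a b :: 'a
  assumes "infinite (UNIV :: 'a set) \<or> CARD('a) \<ge> 3"
  shows "\<exists>t. t \<noteq> a \<and> t \<noteq> b"
proof (rule ccontr)
  assume "\<not> ?thesis"
  then have U: "(UNIV :: 'a set) = {a, b}" by auto
  then have "finite (UNIV :: 'a set)"
    by (metis finite.emptyI finite_insert)
  moreover have "card {a, b} \<le> 2"
    by (cases "a = b") auto
  ultimately show False
    using assms unfolding U by auto
qed

section \<open>The upper bound\<close>

lemma nilpotent_rank_1_affine_dim_le:
  fixes S Z :: "('k::field^'n^'n) set"
  assumes field: "infinite (UNIV :: 'k set) \<or> CARD('k) \<ge> 3"
    and S: "is_affine_subspace S Z"
    and nr: "\<And>A. A \<in> S \<Longrightarrow> nilpotent_matrix A \<and> rank A = 1"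
  shows "matvs.dim Z \<le> CARD('n) - 2"
proof -
  obtain A where Z: "matvs.subspace Z" and SA: "S = (+) A ` Z"
    using S by (auto simp: is_affine_subspace_def)
  have outerS: "\<exists>a b. M = outer a b" and nzS: "M \<noteq> 0" and trS: "trace M = 0" if "M \<in> S" for M
    using nr[OF that] unfolding rank_eq_1_iff by (auto simp: nilpotent_outer_iff)
  have AB: "A + B \<in> S" if "B \<in> Z" for B
    using that SA by blast
  have AS: "A \<in> S"
    using AB[of 0] matvs.subspace_0[OF Z] by simp
  obtain u v where A: "A = outer u v"
    using outerS[OF AS] by blast
  have "u \<noteq> 0" "v \<noteq> 0"
    using nzS[OF AS] A by (auto simp: vec_eq_iff)
  then obtain p q where pq: "u $ p \<noteq> 0" "v $ q \<noteq> 0"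
    by (auto simp: vec_eq_iff)
  \<comment> \<open>Otherwise \<open>- A\<close> is in \<open>Z\<close> and \<open>S\<close>
    contains \<open>A + (- A) = 0\<close>, which does not have rank 1.\<close>
  have AZ: "A \<notin> Z"
    using AB[of "- A"] matvs.subspace_neg[OF Z, of A] nzS by auto
  have trZ: "trace B = 0" if "B \<in> Z" for B
    using trS[OF AB[OF that]] trS[OF AS] by (simp add: trace_add)
  obtain t :: 'k where t: "t \<noteq> 0" "t \<noteq> 1"
    using exists_third_element[OF field] by blast
  have "B \<in> range (outer u) \<union> range (\<lambda>x. outer x v)" if B: "B \<in> Z" for B
  proof -
    obtain u1 v1 u2 v2 where "A + B = outer u1 v1" "A + matrix_scale t B = outer u2 v2"
      using outerS AB B matvs.subspace_scale[OF Z B] by metis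
    then show ?thesis
      using direction_of_rank_1[OF t] nzS[OF AS] A by metis
  qed
  then consider "Z \<subseteq> range (outer u)" | "Z \<subseteq> range (\<lambda>x. outer x v)"
    using matvs.subspace_subset_Un_cases[OF Z subspace_range_outer_left subspace_range_outer_right]
    by (metis subsetI)
  then show ?thesis
  proof cases
    case 1
    \<comment> \<open>The choice of \<open>D\<close> makes its trace equal to \<open>u $ p\<close>,
      which is nonzero; in the other case it is \<open>v $ q\<close>.\<close>
    show ?thesis
      by (rule dim_traceless_bound[OF subspace_range_outer_left range_outer_left_span,
            where D = "outer u (axis p 1)" and A = A])
        (use 1 pq trS[OF AS] AZ Z trZ in \<open>auto simp: A trace_outer_axis_right\<close>)
  next
    case 2
    show ?thesis
      by (rule dim_traceless_bound[OF subspace_range_outer_right range_outer_right_span,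
            where D = "outer (axis q 1) v" and A = A])
        (use 2 pq trS[OF AS] AZ Z trZ in \<open>auto simp: A trace_outer_axis_left\<close>)
  qed
qed

section \<open>A space attaining the bound\<close>

text \<open>The witness consists of the matrices supported in row \<open>a\<close> whose entry is 0
  in column \<open>a\<close> and 1 in column \<open>b\<close>. The first entry makes the trace
  vanish, the second keeps the matrix nonzero, and the other \<open>CARD('n) - 2\<close> entries of
  the row are free.\<close>

lemma nilpotent_rank_1_affine_exists:
  assumes "CARD('n::finite) \<ge> 2"
  shows "\<exists>(S :: ('k::field^'n^'n) set) Z. is_affine_subspace S Z
            \<and> (\<forall>A\<in>S. nilpotent_matrix A \<and> rank A = 1) \<and> matvs.dim Z = CARD('n) - 2"
proof -
  obtain a b :: 'n where ab: "a \<noteq> b"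
    using assms by (metis card_2_iff' ex_card)
  define e where "e j = (outer (axis a 1) (axis j 1) :: 'k^'n^'n)" for j
  define B where "B = e ` (UNIV - {a, b})"
  define Z where "Z = matvs.span B"
  have e_nth: "e j $ i $ k = (if i = a \<and> k = j then 1 else 0)" for i j k
    by (simp add: e_def axis_def)
  have subspace_entry: "matvs.subspace {M :: 'k^'n^'n. M $ i $ j = 0}" for i j
    by (auto simp: matvs.subspace_def)
  have "inj e"
    by (rule injI) (metis e_nth zero_neq_one)
  have ind: "matvs.independent B"
  proof
    assume "matvs.dependent B"
    then obtain j where j: "e j \<in> matvs.span (B - {e j})"
      by (auto simp: matvs.dependent_def B_def)
    \<comment> \<open>The entry in row \<open>a\<close>, column \<open>j\<close> separates
      \<open>e j\<close>, where it is 1, from the span of the other matrix units.\<close>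
    have "matvs.span (B - {e j}) \<subseteq> {M. M $ a $ j = 0}"
      by (rule matvs.span_minimal[OF _ subspace_entry]) (auto simp: B_def e_nth)
    with j show False
      by (auto simp: e_nth)
  qed
  have "card B = card (UNIV - {a, b})"
    unfolding B_def by (rule card_image) (use \<open>inj e\<close> in \<open>auto intro: inj_on_subset\<close>)
  also have "\<dots> = CARD('n) - 2"
    using ab by (subst card_Diff_subset) auto
  finally have dim: "matvs.dim Z = CARD('n) - 2"
    using ind by (simp add: Z_def matvs.dim_eq_card_independent)
  have "nilpotent_matrix (e b + M) \<and> rank (e b + M) = 1" if "M \<in> Z" for M
  proof -
    have "Z \<subseteq> range (outer (axis a 1))"
      unfolding Z_def
      by (rule matvs.span_minimal[OF _ subspace_range_outer_left]) (auto simp: B_def e_def)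
    with that obtain w where w: "M = outer (axis a 1) w"
      by blast
    have zero: "M $ a $ j = 0" if "j \<in> {a, b}" for j
    proof -
      have "Z \<subseteq> {M. M $ a $ j = 0}"
        unfolding Z_def
        by (rule matvs.span_minimal[OF _ subspace_entry]) (use that in \<open>auto simp: B_def e_nth\<close>)
      then show ?thesis
        using \<open>M \<in> Z\<close> by blast
    qed
    \<comment> \<open>Both summands share the left factor \<open>axis a 1\<close>, so the sum is
      again an outer product.\<close>
    have eq: "e b + M = outer (axis a 1) (axis b 1 + w)"
      by (simp add: e_def w vec_eq_iff algebra_simps)
    have wa: "w $ a = 0"
      using zero[of a] by (simp add: w)
    have "(e b + M) $ a $ b = 1"
      using zero[of b] by (simp add: e_nth)
    then have "e b + M \<noteq> 0"
      by (metis zero_index zero_neq_one)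
    moreover have "trace (e b + M) = 0"
      unfolding eq trace_outer_axis_left using wa ab by (simp add: axis_def)
    ultimately show ?thesis
      unfolding rank_eq_1_iff eq nilpotent_outer_iff by blast
  qed
  moreover have "is_affine_subspace ((+) (e b) ` Z) Z"
    by (auto simp: is_affine_subspace_def Z_def)
  ultimately show ?thesis
    using dim by blast
qed

theorem proposition2p8:
  assumes "CARD('n::finite) \<ge> 2"
    and "infinite (UNIV :: 'k::field set) \<or> CARD('k) \<ge> 3"
  shows "(\<exists>(S :: ('k^'n^'n) set) Z. is_affine_subspace S Z
            \<and> (\<forall>A\<in>S. nilpotent_matrix A \<and> rank A = 1) \<and> matvs.dim Z = CARD('n) - 2)
       \<and> (\<forall>(S :: ('k^'n^'n) set) Z. is_affine_subspace S Z
            \<and> (\<forall>A\<in>S. nilpotent_matrix A \<and> rank A = 1) \<longrightarrow> matvs.dim Z \<le> CARD('n) - 2)"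
  using nilpotent_rank_1_affine_exists[OF assms(1)]
    nilpotent_rank_1_affine_dim_le[OF assms(2)] by blast

end
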